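(* Let $\varepsilon\in[0,1)$ and $\Delta\in\{UI,B,B^\varepsilon,D^\varepsilon\}$. Let $X$ be a finite-dimensional Banach space and $Y$ a normed linear space, and let $T\in\mathcal{L}(X,Y)$ with $\|T\|=1$. Then the following are equivalent: (i) $T$ is one-to-one; (ii) $T$ is $\Delta D^{\beta}$-R for some $\beta\in[0,1)$; (iii) $T$ is $\Delta D^{\eta}$-P for some $\eta\in[0,1)$.
   Context: All normed spaces are real; $\mathcal{L}(X,Y)$ is the space of bounded linear operators from $X$ to $Y$ with the operator norm; $S_X=\{x\in X:\|x\|=1\}$. For $x,y$ in a normed space and $\varepsilon\in[0,1)$: $x\perp_B y$ means $\|x+\lambda y\|\ge\|x\|$ for all $\lambda\in\mathbb{R}$; $x\perp_{D^\varepsilon}y$ means $\|x+\lambda y\|\ge\sqrt{1-\varepsilon^2}\,\|x\|$ for all $\lambda\in\mathbb{R}$; $x\perp_{B^\varepsilon}y$ means $\|x+\lambda y\|^2\ge\|x\|^2-2\varepsilon\|x\|\|\lambda y\|$ for all $\lambda\in\mathbb{R}$; $x\perp_{UI}y$ means $\|x\|=\|y\|=1$ and $\|x+y\|=\|x-y\|$. For $\eta\in[0,1)$ and $\Delta\in\{B,B^\varepsilon,D^\varepsilon\}$, $T$ is $\Delta D^\eta$-P (respectively $\Delta D^\eta$-R) if for all $x,y\in X$, $x\perp_\Delta y$ implies $Tx\perp_{D^\eta}Ty$ (respectively $Ty\perp_{D^\eta}Tx$). For $\Delta=UI$ the same definition is used with $x,y$ restricted to $S_X$. *)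

theory Defs
  imports "HOL-Analysis.Bounded_Linear_Function"
begin

definition orth_B :: "'a::real_normed_vector \<Rightarrow> 'a \<Rightarrow> bool" where
  "orth_B x y \<longleftrightarrow> (\<forall>l::real. norm (x + l *\<^sub>R y) \<ge> norm x)"

definition orth_D :: "real \<Rightarrow> 'a::real_normed_vector \<Rightarrow> 'a \<Rightarrow> bool" where
  "orth_D \<epsilon> x y \<longleftrightarrow>
     (\<forall>l::real. norm (x + l *\<^sub>R y) \<ge> sqrt (1 - \<epsilon>\<^sup>2) * norm x)"

definition orth_Beps :: "real \<Rightarrow> 'a::real_normed_vector \<Rightarrow> 'a \<Rightarrow> bool" where
  "orth_Beps \<epsilon> x y \<longleftrightarrow>
     (\<forall>l::real. (norm (x + l *\<^sub>R y))\<^sup>2 \<ge> (norm x)\<^sup>2 - 2 * \<epsilon> * norm x * norm (l *\<^sub>R y))"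

definition orth_UI :: "'a::real_normed_vector \<Rightarrow> 'a \<Rightarrow> bool" where
  "orth_UI x y \<longleftrightarrow> norm x = 1 \<and> norm y = 1 \<and> norm (x + y) = norm (x - y)"

text \<open>The relation \<open>\<Delta>\<close> is a parameter of the preserving and reversing properties. Since
  \<open>orth_UI\<close> relates unit vectors only, quantifying over all \<open>x\<close> and \<open>y\<close> agrees, for
  \<open>\<Delta> = orth_UI\<close>, with the definition in which \<open>x\<close> and \<open>y\<close> range over the unit sphere.\<close>

definition D_preserving ::
  "('a::real_normed_vector \<Rightarrow> 'a \<Rightarrow> bool) \<Rightarrow> real \<Rightarrow>
    ('a \<Rightarrow>\<^sub>L 'b::real_normed_vector) \<Rightarrow> bool" where
  "D_preserving \<Delta> \<eta> T \<longleftrightarrow>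
     (\<forall>x y. \<Delta> x y \<longrightarrow> orth_D \<eta> (blinfun_apply T x) (blinfun_apply T y))"

definition D_reversing ::
  "('a::real_normed_vector \<Rightarrow> 'a \<Rightarrow> bool) \<Rightarrow> real \<Rightarrow>
    ('a \<Rightarrow>\<^sub>L 'b::real_normed_vector) \<Rightarrow> bool" where
  "D_reversing \<Delta> \<eta> T \<longleftrightarrow>
     (\<forall>x y. \<Delta> x y \<longrightarrow> orth_D \<eta> (blinfun_apply T y) (blinfun_apply T x))"

end

theory Submission
  imports Defs
begin

text \<open>Each of the four relations forces a bound \<open>norm (x + l *\<^sub>R y) \<ge> c * norm x\<close> with a constant
  \<open>c > 0\<close>, and such a bound is symmetric in \<open>x\<close> and \<open>y\<close> up to halving \<open>c\<close>. An injective operator on a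
  finite-dimensional space is bounded below, so it transports the bound. Conversely, if \<open>T z = 0\<close> with
  \<open>z \<noteq> 0\<close>, then some plane through \<open>z\<close> is mapped by \<open>T\<close> onto a line, and it contains a related pair
  outside the kernel of \<open>T\<close>; the images of this pair are nonzero and parallel.\<close>

section \<open>Injective operators on finite-dimensional spaces\<close>

text \<open>The box over \<open>insert a B\<close> is the Minkowski sum of the segment from
  \<open>- a\<close> to \<open>a\<close> and the box over \<open>B\<close>, so compactness passes
  through the induction.\<close>

lemma compact_coefficient_box:
  fixes B :: "'a::real_normed_vector set"
  assumes "finite B"
  shows "compact {\<Sum>b\<in>B. c b *\<^sub>R b | c. \<forall>b\<in>B. \<bar>c b\<bar> \<le> 1}"
  using assms
proof induction
  case empty
  show ?case by simp
next
  case (insert a B)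
  let ?S = "(\<lambda>t::real. t *\<^sub>R a) ` {-1..1}"
  let ?K = "{\<Sum>b\<in>B. c b *\<^sub>R b | c. \<forall>b\<in>B. \<bar>c b\<bar> \<le> 1}"
  let ?L = "{\<Sum>b\<in>insert a B. c b *\<^sub>R b | c. \<forall>b\<in>insert a B. \<bar>c b\<bar> \<le> 1}"
  have "compact ?S"
    by (intro compact_continuous_image continuous_intros) simp
  then have "compact {x + y | x y. x \<in> ?S \<and> y \<in> ?K}"
    using insert.IH by (rule compact_sums)
  moreover have "{x + y | x y. x \<in> ?S \<and> y \<in> ?K} = ?L"
  proof (intro set_eqI iffI)
    fix v
    assume "v \<in> {x + y | x y. x \<in> ?S \<and> y \<in> ?K}"
    then obtain t c where tc: "t \<in> {-1..1}" "\<forall>b\<in>B. \<bar>c b\<bar> \<le> 1"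
      and v: "v = t *\<^sub>R a + (\<Sum>b\<in>B. c b *\<^sub>R b)"
      by auto
    have "(\<Sum>b\<in>B. c b *\<^sub>R b) = (\<Sum>b\<in>B. (c(a := t)) b *\<^sub>R b)"
      using insert.hyps by (intro sum.cong) auto
    then have "v = (\<Sum>b\<in>insert a B. (c(a := t)) b *\<^sub>R b)"
      using v insert.hyps by simp
    moreover have "\<forall>b\<in>insert a B. \<bar>(c(a := t)) b\<bar> \<le> 1"
      using tc by auto
    ultimately show "v \<in> ?L" by blast
  next
    fix v
    assume "v \<in> ?L"
    then obtain c where c: "\<forall>b\<in>insert a B. \<bar>c b\<bar> \<le> 1"
      and v: "v = (\<Sum>b\<in>insert a B. c b *\<^sub>R b)"
      by blast
    have "v = c a *\<^sub>R a + (\<Sum>b\<in>B. c b *\<^sub>R b)"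
      using v insert.hyps by simp
    moreover have "c a *\<^sub>R a \<in> ?S"
      using c by (intro imageI) auto
    ultimately show "v \<in> {x + y | x y. x \<in> ?S \<and> y \<in> ?K}"
      using c by blast
  qed
  ultimately show ?case by simp
qed

text \<open>Scale \<open>v\<close> so that its basis coefficient of largest absolute value becomes
  1. The scaled vector lies in one of finitely many compact sets avoiding 0, on each of which the
  norm of the image has a positive minimum; undoing the scaling costs a factor
  \<open>N\<close>.\<close>

lemma inj_bounded_below_finite_dim:
  fixes f :: "'a::real_normed_vector \<Rightarrow> 'b::real_normed_vector" and S :: "'a set"
  assumes f: "bounded_linear f" and inj: "inj f"
    and S: "finite S" "span S = UNIV"
  obtains m where "m > 0" and "\<And>v. m * norm v \<le> norm (f v)"
proof -
  interpret f: bounded_linear f by fact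
  obtain B where B: "B \<subseteq> S" "independent B" "span B = span S"
    by (metis basis_exists[of S] span_mono span_minimal subspace_span subset_antisym)
  have fin: "finite B" using B(1) S(1) finite_subset by blast
  have f0: "f v = 0 \<longleftrightarrow> v = 0" for v
    using inj f.zero by (metis injD)
  have "\<exists>d>0. \<forall>c. c j = 1 \<longrightarrow> (\<forall>b\<in>B. \<bar>c b\<bar> \<le> 1) \<longrightarrow> d \<le> norm (f (\<Sum>b\<in>B. c b *\<^sub>R b))"
    if j: "j \<in> B" for j
  proof -
    \<comment> \<open>The coefficient of \<open>j\<close> is held at 1 while the others range over a
      compact box; independence keeps \<open>j + w\<close> away from 0.\<close>
    let ?K = "{\<Sum>b\<in>B - {j}. c b *\<^sub>R b | c. \<forall>b\<in>B - {j}. \<bar>c b\<bar> \<le> 1}"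
    let ?g = "\<lambda>w. norm (f (j + w))"
    have "compact ?K"
      using fin by (intro compact_coefficient_box) simp
    moreover have "(\<Sum>b\<in>B - {j}. 0 *\<^sub>R b) \<in> ?K"
      by (intro CollectI exI[of _ "\<lambda>_. 0"]) auto
    then have "?K \<noteq> {}" by blast
    moreover have "continuous_on ?K ?g"
      by (intro continuous_intros f.continuous_on)
    ultimately have "\<exists>w\<in>?K. \<forall>w'\<in>?K. ?g w \<le> ?g w'"
      by (rule continuous_attains_inf)
    then obtain w where w: "w \<in> ?K" "\<And>w'. w' \<in> ?K \<Longrightarrow> ?g w \<le> ?g w'"
      by (elim bexE) (rule that, assumption, erule (1) bspec)
    have "w \<in> span (B - {j})"
      using w(1) by (auto intro!: span_sum span_scale intro: span_base)
    have "j + w \<noteq> 0"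
    proof
      assume "j + w = 0"
      then have "j = - w" by (simp add: eq_neg_iff_add_eq_0)
      then have "j \<in> span (B - {j})"
        using \<open>w \<in> span (B - {j})\<close> span_neg by metis
      then show False using B(2) j dependent_def by blast
    qed
    then have "?g w > 0" using f0 by simp
    moreover have "?g w \<le> norm (f (\<Sum>b\<in>B. c b *\<^sub>R b))"
      if c: "c j = 1" "\<forall>b\<in>B. \<bar>c b\<bar> \<le> 1" for c
    proof -
      have "(\<Sum>b\<in>B. c b *\<^sub>R b) = j + (\<Sum>b\<in>B - {j}. c b *\<^sub>R b)"
        using c(1) fin j by (simp add: sum.remove)
      moreover have "(\<Sum>b\<in>B - {j}. c b *\<^sub>R b) \<in> ?K" using c(2) by blast
      ultimately show ?thesis using w(2) by simp
    qed
    ultimately show ?thesis by (intro exI[of _ "?g w"]) simp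
  qed
  then obtain d where d: "\<And>j. j \<in> B \<Longrightarrow> d j > 0"
    "\<And>j c. j \<in> B \<Longrightarrow> c j = 1 \<Longrightarrow> (\<forall>b\<in>B. \<bar>c b\<bar> \<le> 1) \<Longrightarrow> d j \<le> norm (f (\<Sum>b\<in>B. c b *\<^sub>R b))"
    by metis
  \<comment> \<open>Inserting 1 keeps the set nonempty when \<open>B\<close> is empty.\<close>
  define \<delta> where "\<delta> = Min (insert 1 (d ` B))"
  have \<delta>: "\<delta> > 0" "\<And>j. j \<in> B \<Longrightarrow> \<delta> \<le> d j"
    using fin d(1) by (auto simp: \<delta>_def)
  \<comment> \<open>\<open>norm v\<close> is at most \<open>N\<close> times the largest absolute
    coefficient; the summand 1 makes \<open>N\<close> positive even for empty
    \<open>B\<close>.\<close>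
  define N where "N = 1 + (\<Sum>b\<in>B. norm b)"
  have N: "N > 0" by (simp add: N_def add_pos_nonneg sum_nonneg)
  show thesis
  proof
    show "\<delta> / N > 0" using \<delta> N by simp
    fix v
    have "v \<in> span B" using B S by simp
    then obtain c where v: "v = (\<Sum>b\<in>B. c b *\<^sub>R b)"
      using span_finite[OF fin] by auto
    show "\<delta> / N * norm v \<le> norm (f v)"
    proof (cases "v = 0")
      case False
      then have "B \<noteq> {}" using v by auto
      then have "Max ((\<lambda>b. \<bar>c b\<bar>) ` B) \<in> (\<lambda>b. \<bar>c b\<bar>) ` B"
        using fin by (intro Max_in) auto
      then obtain j where j: "j \<in> B" and max: "Max ((\<lambda>b. \<bar>c b\<bar>) ` B) = \<bar>c j\<bar>"
        by (rule imageE)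
      have le: "\<bar>c b\<bar> \<le> \<bar>c j\<bar>" if "b \<in> B" for b
        unfolding max[symmetric] using fin that by (intro Max_ge) auto
      have cj: "c j \<noteq> 0"
      proof
        assume "c j = 0"
        then have "c b = 0" if "b \<in> B" for b using le[OF that] by simp
        then show False using False v by simp
      qed
      \<comment> \<open>The quotients \<open>c b / c j\<close> are at most 1 in absolute value and
        the one at \<open>j\<close> equals 1, as \<open>d j\<close> requires.\<close>
      have "\<delta> \<le> norm (f (\<Sum>b\<in>B. (c b / c j) *\<^sub>R b))"
        using le j cj \<delta>(2)[OF j] d(2)[OF j, of "\<lambda>b. c b / c j"]
        by (auto simp: divide_simps)
      also have "(\<Sum>b\<in>B. (c b / c j) *\<^sub>R b) = inverse (c j) *\<^sub>R v"
        by (simp add: v scaleR_sum_right divide_inverse mult.commute)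
      finally have "\<delta> * \<bar>c j\<bar> \<le> norm (f v)"
        using cj by (simp add: f.scaleR divide_simps)
      moreover have "norm v \<le> N * \<bar>c j\<bar>"
      proof -
        have "norm v \<le> (\<Sum>b\<in>B. \<bar>c j\<bar> * norm b)"
          unfolding v using le by (intro sum_norm_le) (simp add: mult_right_mono)
        also have "\<dots> \<le> N * \<bar>c j\<bar>"
          by (simp only: N_def sum_distrib_left[symmetric]) (simp add: algebra_simps)
        finally show ?thesis .
      qed
      then have "\<delta> / N * norm v \<le> \<delta> / N * (N * \<bar>c j\<bar>)"
        using \<delta>(1) N by (intro mult_left_mono) auto
      ultimately show ?thesis using N by simp
    qed (simp add: f.zero)
  qed
qed

section \<open>Approximate orthogonality as a lower bound\<close>

text \<open>Translates between lower bounds and approximate orthogonality: for this parameter the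
  factor in \<open>orth_D\<close> collapses to \<open>c\<close>.\<close>

lemma orth_D_sqrt_iff:
  assumes "0 \<le> c" "c \<le> 1"
  shows "orth_D (sqrt (1 - c\<^sup>2)) x y \<longleftrightarrow> (\<forall>l. c * norm x \<le> norm (x + l *\<^sub>R y))"
proof -
  have "c\<^sup>2 \<le> 1" using assms by (simp add: power_le_one)
  then show ?thesis using assms by (simp add: orth_D_def)
qed

text \<open>If \<open>l *\<^sub>R x\<close> has at least half the length of \<open>y\<close>,
  rescaling by \<open>inverse l\<close> reduces the claim to the hypothesis. Otherwise the triangle
  inequality alone leaves half of \<open>norm y\<close>.\<close>

lemma lower_bound_swap:
  fixes x y :: "'a::real_normed_vector"
  assumes c: "0 \<le> c" "c \<le> 1" and lb: "\<And>l. c * norm x \<le> norm (x + l *\<^sub>R y)"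
  shows "c / 2 * norm y \<le> norm (y + l *\<^sub>R x)"
proof (cases "norm y \<le> 2 * norm (l *\<^sub>R x)")
  case True
  show ?thesis
  proof (cases "l = 0")
    case False
    then have "norm (y + l *\<^sub>R x) = \<bar>l\<bar> * norm (x + inverse l *\<^sub>R y)"
      by (simp flip: norm_scaleR add: scaleR_right_distrib add.commute)
    also have "\<dots> \<ge> \<bar>l\<bar> * (c * norm x)"
      using lb by (intro mult_left_mono) auto
    finally have "c * norm (l *\<^sub>R x) \<le> norm (y + l *\<^sub>R x)"
      by (simp add: mult_ac)
    moreover have "c * norm y \<le> c * (2 * norm (l *\<^sub>R x))"
      using True c by (intro mult_left_mono) auto
    ultimately show ?thesis by simp
  qed (use True in simp)
next
  case False
  have "c * norm y \<le> 1 * norm y" using c by (intro mult_right_mono) auto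
  moreover have "norm y \<le> norm (y + l *\<^sub>R x) + norm (l *\<^sub>R x)"
    by (metis add_diff_cancel_right' norm_triangle_ineq4)
  ultimately show ?thesis using False by linarith
qed

text \<open>The squared condition is void once \<open>2 * \<epsilon> * norm (l *\<^sub>R y)\<close>
  reaches \<open>norm x\<close>. Used only near \<open>l = 0\<close>, it bounds a slope, and
  convexity of the norm extends the resulting linear bound to every \<open>l\<close>.\<close>

lemma orth_Beps_supporting_line:
  assumes "0 \<le> \<epsilon>" "orth_Beps \<epsilon> x y"
  shows "norm x - \<epsilon> * norm (l *\<^sub>R y) \<le> norm (x + l *\<^sub>R y)"
proof (cases "x = 0")
  case True
  then have "norm x - \<epsilon> * norm (l *\<^sub>R y) \<le> 0" using assms(1) by simp
  then show ?thesis using norm_ge_zero order_trans by blast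
next
  case False
  let ?a = "norm x" and ?b = "norm (l *\<^sub>R y)" and ?N = "norm (x + l *\<^sub>R y)"
  \<comment> \<open>\<open>t * ?h t\<close> is the gap between the convexity upper bound and the
    hypothesis' lower bound for the squared norm at \<open>t * l\<close>; dividing by
    \<open>t\<close> and letting it tend to 0 leaves the slope inequality.\<close>
  let ?h = "\<lambda>t::real. - 2 * ?a\<^sup>2 + t * ?a\<^sup>2 + 2 * (1 - t) * ?a * ?N + t * ?N\<^sup>2 + 2 * \<epsilon> * ?a * ?b"
  have pos: "?h t \<ge> 0" if t: "0 < t" "t < 1" for t
  proof -
    have "x + (t * l) *\<^sub>R y = (1 - t) *\<^sub>R x + t *\<^sub>R (x + l *\<^sub>R y)"
      by (simp add: algebra_simps)
    then have "norm (x + (t * l) *\<^sub>R y) \<le> (1 - t) * ?a + t * ?N"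
      using t norm_triangle_ineq[of "(1 - t) *\<^sub>R x" "t *\<^sub>R (x + l *\<^sub>R y)"] by simp
    then have "(norm (x + (t * l) *\<^sub>R y))\<^sup>2 \<le> ((1 - t) * ?a + t * ?N)\<^sup>2"
      by (intro power_mono) auto
    moreover have "?a\<^sup>2 - 2 * \<epsilon> * ?a * norm ((t * l) *\<^sub>R y) \<le> (norm (x + (t * l) *\<^sub>R y))\<^sup>2"
      using assms unfolding orth_Beps_def by blast
    moreover have "norm ((t * l) *\<^sub>R y) = t * ?b" using t by (simp add: abs_mult)
    ultimately have "?a\<^sup>2 - 2 * \<epsilon> * ?a * (t * ?b) \<le> ((1 - t) * ?a + t * ?N)\<^sup>2"
      by (simp only: mult.assoc)
    then have "0 \<le> t * ?h t"
      by (simp add: power2_eq_square algebra_simps)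
    then show ?thesis using t by (simp add: zero_le_mult_iff)
  qed
  have "((\<lambda>t. ?h t) \<longlongrightarrow> ?h 0) (at_right 0)"
    by (intro tendsto_intros)
  moreover have "eventually (\<lambda>t. 0 \<le> ?h t) (at_right 0)"
    using pos unfolding eventually_at_right_field by (intro exI[of _ 1]) simp
  ultimately have "?h 0 \<ge> 0"
    by (rule tendsto_lowerbound) simp
  then have "0 \<le> ?a * (?N - ?a + \<epsilon> * ?b)"
    by (simp add: power2_eq_square algebra_simps)
  then show ?thesis using False by (simp add: zero_le_mult_iff)
qed

text \<open>The supporting line is strong for short \<open>l *\<^sub>R y\<close>, the triangle
  inequality for long ones; adding \<epsilon> times the latter cancels
  \<open>norm (l *\<^sub>R y)\<close>.\<close>

lemma orth_Beps_lower_bound: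
  assumes \<epsilon>: "0 \<le> \<epsilon>" and xy: "orth_Beps \<epsilon> x y"
  shows "(1 - \<epsilon>) / (1 + \<epsilon>) * norm x \<le> norm (x + l *\<^sub>R y)"
proof -
  let ?N = "norm (x + l *\<^sub>R y)" and ?b = "norm (l *\<^sub>R y)"
  have "norm x - \<epsilon> * ?b \<le> ?N"
    using \<epsilon> xy by (rule orth_Beps_supporting_line)
  moreover have "?b - norm x \<le> ?N"
    by (metis add.commute norm_diff_ineq)
  then have "\<epsilon> * (?b - norm x) \<le> \<epsilon> * ?N"
    using \<epsilon> by (rule mult_left_mono)
  ultimately have "(1 - \<epsilon>) * norm x \<le> (1 + \<epsilon>) * ?N"
    by (simp add: algebra_simps)
  then show ?thesis using \<epsilon> by (simp add: field_simps)
qed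

text \<open>The equal norms of \<open>x + y\<close> and \<open>x - y\<close> are at least 1, as
  these vectors sum to \<open>2 *\<^sub>R x\<close>. Both \<open>1 - d\<close> and \<open>d\<close>
  bound the norm at \<open>l\<close> from below, where \<open>d\<close> is the distance from
  \<open>l\<close> to the nearer of 1 and -1.\<close>

lemma orth_UI_lower_bound:
  assumes "orth_UI x y"
  shows "1 / 2 * norm x \<le> norm (x + l *\<^sub>R y)"
proof -
  have n: "norm x = 1" "norm y = 1" "norm (x + y) = norm (x - y)"
    using assms by (auto simp: orth_UI_def)
  have "norm ((x + y) + (x - y)) \<le> norm (x + y) + norm (x - y)"
    by (rule norm_triangle_ineq)
  moreover have "(x + y) + (x - y) = 2 *\<^sub>R x" by (simp add: scaleR_2)
  ultimately have "norm (x + y) \<ge> 1" using n by simp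
  then have ge1: "norm (x + s *\<^sub>R y) \<ge> 1" if "s = 1 \<or> s = -1" for s
    using n that by auto
  define s :: real where "s = (if l \<ge> 0 then 1 else -1)"
  have "norm (x + s *\<^sub>R y) \<le> norm (x + l *\<^sub>R y) + norm ((s - l) *\<^sub>R y)"
    using norm_triangle_ineq[of "x + l *\<^sub>R y" "(s - l) *\<^sub>R y"] by (simp add: algebra_simps)
  moreover have "norm ((s - l) *\<^sub>R y) = \<bar>1 - \<bar>l\<bar>\<bar>"
    using n by (simp add: s_def abs_if)
  moreover have "\<bar>1 - \<bar>l\<bar>\<bar> \<le> norm (x + l *\<^sub>R y)"
    using norm_triangle_ineq3[of x "- l *\<^sub>R y"] n by simp
  ultimately show ?thesis using ge1[of s] n by (auto simp: s_def split: if_splits)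
qed

text \<open>One constant must serve all pairs, since it determines the parameter of the operator
  properties.\<close>

lemma orth_uniform_lower_bound:
  fixes \<Delta> :: "'a::real_normed_vector \<Rightarrow> 'a \<Rightarrow> bool"
  assumes \<epsilon>: "\<epsilon> \<in> {0..<1}" and \<Delta>: "\<Delta> \<in> {orth_UI, orth_B, orth_Beps \<epsilon>, orth_D \<epsilon>}"
  obtains c where "0 < c" "c \<le> 1" "\<And>x y l. \<Delta> x y \<Longrightarrow> c * norm x \<le> norm (x + l *\<^sub>R y)"
proof -
  consider "\<Delta> = orth_UI" | "\<Delta> = orth_B" | "\<Delta> = orth_Beps \<epsilon>" | "\<Delta> = orth_D \<epsilon>"
    using \<Delta> by blast
  then show thesis
  proof cases
    case 1
    then show ?thesis using that[of "1/2"] orth_UI_lower_bound by auto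
  next
    case 2
    then show ?thesis using that[of 1] by (auto simp: orth_B_def)
  next
    case 3
    then show ?thesis using that[of "(1 - \<epsilon>) / (1 + \<epsilon>)"] \<epsilon> orth_Beps_lower_bound by auto
  next
    case 4
    have "\<epsilon>\<^sup>2 < 1" using \<epsilon> by (simp add: abs_square_less_1)
    then show ?thesis using 4 that[of "sqrt (1 - \<epsilon>\<^sup>2)"] by (auto simp: orth_D_def)
  qed
qed

section \<open>Related pairs outside the kernel\<close>

lemma orth_B_imp_orth_Beps:
  assumes "0 \<le> \<epsilon>" "orth_B x y"
  shows "orth_Beps \<epsilon> x y"
  unfolding orth_Beps_def
proof
  fix l
  have "(norm x)\<^sup>2 \<le> (norm (x + l *\<^sub>R y))\<^sup>2"
    using assms(2) by (intro power_mono) (auto simp: orth_B_def)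
  moreover have "0 \<le> 2 * \<epsilon> * norm x * norm (l *\<^sub>R y)" using assms(1) by simp
  ultimately show "(norm x)\<^sup>2 - 2 * \<epsilon> * norm x * norm (l *\<^sub>R y) \<le> (norm (x + l *\<^sub>R y))\<^sup>2"
    by linarith
qed

lemma orth_B_imp_orth_D:
  assumes "orth_B x y"
  shows "orth_D \<epsilon> x y"
  unfolding orth_D_def
proof
  fix l
  have "sqrt (1 - \<epsilon>\<^sup>2) * norm x \<le> 1 * norm x"
    by (intro mult_right_mono) auto
  then show "sqrt (1 - \<epsilon>\<^sup>2) * norm x \<le> norm (x + l *\<^sub>R y)"
    using assms by (fastforce simp: orth_B_def intro: order_trans)
qed

lemma orth_B_foot_exists:
  fixes x y :: "'a::real_normed_vector"
  assumes "y \<noteq> 0"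
  obtains t where "orth_B (x + t *\<^sub>R y) y"
proof -
  \<comment> \<open>Beyond \<open>R\<close> the vector \<open>l *\<^sub>R y\<close> is at least
    twice as long as \<open>x\<close>, so no value there is below the value at
    \<open>l = 0\<close>.\<close>
  define R where "R = 2 * norm x / norm y"
  have "R \<ge> 0" by (simp add: R_def)
  have "continuous_on {-R..R} (\<lambda>l. norm (x + l *\<^sub>R y))"
    by (intro continuous_intros)
  then obtain t where t: "\<And>l. l \<in> {-R..R} \<Longrightarrow> norm (x + t *\<^sub>R y) \<le> norm (x + l *\<^sub>R y)"
    using continuous_attains_inf[of "{-R..R}" "\<lambda>l. norm (x + l *\<^sub>R y)"] \<open>R \<ge> 0\<close> by fastforce
  have "norm (x + t *\<^sub>R y) \<le> norm (x + l *\<^sub>R y)" for l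
  proof (cases "l \<in> {-R..R}")
    case False
    then have "R < \<bar>l\<bar>" by auto
    then have "2 * norm x \<le> norm (l *\<^sub>R y)"
      using assms by (simp add: R_def field_simps)
    moreover have "norm (l *\<^sub>R y) - norm x \<le> norm (x + l *\<^sub>R y)"
      by (metis add.commute norm_diff_ineq)
    moreover have "norm (x + t *\<^sub>R y) \<le> norm x" using t[of 0] \<open>R \<ge> 0\<close> by simp
    ultimately show ?thesis by linarith
  qed (rule t)
  then have "orth_B (x + t *\<^sub>R y) y"
    unfolding orth_B_def by (metis add.assoc scaleR_left_distrib)
  then show thesis by (rule that)
qed

text \<open>The plane of \<open>z\<close> and \<open>u\<close> is mapped onto the line through
  \<open>f u\<close>. Tilting \<open>z\<close> slightly towards \<open>u\<close> gives
  \<open>y\<close>; the other vector is the foot of \<open>z\<close> along direction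
  \<open>y\<close>.\<close>

lemma orth_B_pair_outside_kernel:
  fixes f :: "'a::real_normed_vector \<Rightarrow> 'b::real_normed_vector"
  assumes f: "linear f" and z: "z \<noteq> 0" "f z = 0" and u: "f u \<noteq> 0"
  obtains x y a b where "orth_B x y" "f x = a *\<^sub>R f u" "f y = b *\<^sub>R f u" "a \<noteq> 0" "b \<noteq> 0"
proof -
  have "u \<noteq> 0" using f u linear_0 by blast
  \<comment> \<open>This makes \<open>b *\<^sub>R u\<close> half as long as
    \<open>z\<close>.\<close>
  define b where "b = norm z / (2 * norm u)"
  have b: "b > 0" using \<open>u \<noteq> 0\<close> z by (simp add: b_def)
  define y where "y = z + b *\<^sub>R u"
  have fy: "f y = b *\<^sub>R f u" using f z by (simp add: y_def linear_add linear_scale)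
  then have "y \<noteq> 0" using b u f linear_0 by fastforce
  then obtain t where t: "orth_B (z + t *\<^sub>R y) y" by (rule orth_B_foot_exists)
  \<comment> \<open>\<open>y\<close> is so close to \<open>z\<close> that \<open>z\<close> itself is not the foot, so \<open>t\<close> is nonzero.\<close>
  have "t \<noteq> 0"
  proof
    assume "t = 0"
    then have "norm z \<le> norm (z + (-1) *\<^sub>R y)" using t by (auto simp only: orth_B_def scaleR_zero_left add_0_right)
    also have "\<dots> = norm z / 2" using b \<open>u \<noteq> 0\<close> by (simp add: y_def b_def)
    finally show False using z by simp
  qed
  moreover have "f (z + t *\<^sub>R y) = (t * b) *\<^sub>R f u"
    using f z fy by (simp add: linear_add linear_scale)
  ultimately show thesis using that[OF t _ fy, of "t * b"] b by simp
qed

text \<open>Fix a unit vector \<open>x\<close> outside the kernel but close to a unit kernel vector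
  \<open>w\<close>. The intermediate value theorem yields a partner on an arc whose only kernel
  vector is \<open>w\<close>, and \<open>w\<close> is too close to \<open>x\<close> to be that
  partner.\<close>

lemma orth_UI_pair_outside_kernel:
  fixes f :: "'a::real_normed_vector \<Rightarrow> 'b::real_normed_vector"
  assumes f: "linear f" and z: "z \<noteq> 0" "f z = 0" and u: "f u \<noteq> 0"
  obtains x y a b where "orth_UI x y" "f x = a *\<^sub>R f u" "f y = b *\<^sub>R f u" "a \<noteq> 0" "b \<noteq> 0"
proof -
  have "u \<noteq> 0" using f u linear_0 by blast
  define w where "w = sgn z"
  have w: "norm w = 1" "f w = 0"
    using z f by (auto simp: w_def norm_sgn sgn_div_norm linear_scale)
  \<comment> \<open>The shift has length 1/4 and normalizing \<open>p\<close> moves it by at most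
    another 1/4, so \<open>x\<close> stays within 1/2 of \<open>w\<close>.\<close>
  define p where "p = w + (1 / (4 * norm u)) *\<^sub>R u"
  have fp: "f p = (1 / (4 * norm u)) *\<^sub>R f u"
    using f w by (simp add: p_def linear_add linear_scale)
  have pw: "norm (p - w) = 1 / 4" using \<open>u \<noteq> 0\<close> by (simp add: p_def)
  have np: "\<bar>norm p - 1\<bar> \<le> 1 / 4" using norm_triangle_ineq3[of p w] w pw by simp
  have "p \<noteq> 0" using np by auto
  define x where "x = sgn p"
  have x: "norm x = 1" using \<open>p \<noteq> 0\<close> by (simp add: x_def norm_sgn)
  have "x - p = (1 - norm p) *\<^sub>R x"
    using \<open>p \<noteq> 0\<close> by (simp add: x_def sgn_div_norm algebra_simps)
  then have "norm (x - p) \<le> 1 / 4" using np x by (simp add: abs_minus_commute)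
  then have xw: "norm (x - w) \<le> 1 / 2"
    using norm_triangle_ineq[of "x - p" "p - w"] pw by simp
  define a where "a = inverse (norm p) * (1 / (4 * norm u))"
  have a: "a \<noteq> 0" "f x = a *\<^sub>R f u"
    using \<open>p \<noteq> 0\<close> \<open>u \<noteq> 0\<close> f fp by (simp_all add: x_def a_def sgn_div_norm linear_scale)

  text \<open>Moving from \<open>-x\<close> to \<open>x\<close> on the unit circle of the plane, \<open>norm (x + y) - norm (x - y)\<close>
    changes sign.\<close>
  define q where "q s = s *\<^sub>R x + (1 - \<bar>s\<bar>) *\<^sub>R w" for s :: real
  have fq: "f (q s) = (s * a) *\<^sub>R f u" for s
    using f w a by (simp add: q_def linear_add linear_scale)
  \<comment> \<open>The path must avoid 0 for \<open>sgn\<close> to be continuous along it: applying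
    \<open>f\<close> forces \<open>s = 0\<close>, but \<open>q 0\<close> is
    \<open>w\<close>.\<close>
  have q0: "q s \<noteq> 0" for s
  proof
    assume "q s = 0"
    then have "f (q s) = 0" using f linear_0 by metis
    then have "s = 0" using fq[of s] a u by simp
    then show False using \<open>q s = 0\<close> w by (auto simp: q_def)
  qed
  have cq: "continuous_on {-1..1} (\<lambda>s. sgn (q s))"
    unfolding q_def[abs_def] using q0[unfolded q_def]
    by (intro continuous_on_sgn continuous_intros) auto
  define h where "h s = norm (x + sgn (q s)) - norm (x - sgn (q s))" for s
  have "continuous_on {-1..1} h"
    unfolding h_def[abs_def] by (intro continuous_intros cq)
  moreover have "sgn x = x" using x by (simp add: sgn_div_norm)
  then have "h (-1) \<le> 0" "0 \<le> h 1" by (simp_all add: h_def q_def sgn_minus)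
  ultimately obtain s where s: "h s = 0"
    using IVT'[of h "-1" 0 1] by auto
  define y where "y = sgn (q s)"
  have y: "norm y = 1" using q0 by (simp add: y_def norm_sgn)
  have eq: "norm (x + y) = norm (x - y)" using s by (simp add: h_def y_def)
  \<comment> \<open>At \<open>s = 0\<close> the partner would be \<open>w\<close>, and both
    \<open>x + w\<close> and \<open>x - w\<close> would have norm at most 1/2 although their sum has
    norm 2.\<close>
  have "s \<noteq> 0"
  proof
    assume "s = 0"
    then have "y = w" using w by (simp add: y_def q_def sgn_div_norm)
    then have "norm (x + w) \<le> 1 / 2" using eq xw by simp
    moreover have "norm ((x + w) + (x - w)) \<le> norm (x + w) + norm (x - w)"
      by (rule norm_triangle_ineq)
    moreover have "(x + w) + (x - w) = 2 *\<^sub>R x" by (simp add: scaleR_2)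
    ultimately show False using xw x by simp
  qed
  then have "inverse (norm (q s)) * (s * a) \<noteq> 0" using a q0 by simp
  moreover have "f y = (inverse (norm (q s)) * (s * a)) *\<^sub>R f u"
    using f fq by (simp add: y_def sgn_div_norm linear_scale)
  moreover have "orth_UI x y" using x y eq by (simp add: orth_UI_def)
  ultimately show thesis using that a by blast
qed

text \<open>\<open>orth_B\<close> implies both of its approximate versions, so one construction
  serves three relations; only \<open>orth_UI\<close> needs its own.\<close>

lemma orth_pair_outside_kernel:
  fixes f :: "'a::real_normed_vector \<Rightarrow> 'b::real_normed_vector"
  assumes \<epsilon>: "\<epsilon> \<in> {0..<1}" and \<Delta>: "\<Delta> \<in> {orth_UI, orth_B, orth_Beps \<epsilon>, orth_D \<epsilon>}"
    and f: "linear f" and z: "z \<noteq> 0" "f z = 0" and u: "f u \<noteq> 0"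
  obtains x y a b where "\<Delta> x y" "f x = a *\<^sub>R f u" "f y = b *\<^sub>R f u" "a \<noteq> 0" "b \<noteq> 0"
proof (cases "\<Delta> = orth_UI")
  case True
  then show ?thesis using orth_UI_pair_outside_kernel[OF f z u] that by metis
next
  case False
  then have "\<Delta> x y" if "orth_B x y" for x y
    using that \<Delta> \<epsilon> orth_B_imp_orth_Beps orth_B_imp_orth_D by auto
  then show ?thesis using orth_B_pair_outside_kernel[OF f z u] that by metis
qed

section \<open>Parallel images and the two equivalences\<close>

lemma not_orth_D_parallel:
  assumes "\<eta> \<in> {0..<1}" "a \<noteq> 0" "b \<noteq> 0" "v \<noteq> 0"
  shows "\<not> orth_D \<eta> (a *\<^sub>R v) (b *\<^sub>R v)"
proof
  assume "orth_D \<eta> (a *\<^sub>R v) (b *\<^sub>R v)"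
  \<comment> \<open>The choice \<open>l = - a / b\<close> cancels the two parallel vectors, while
    \<open>\<eta> < 1\<close> keeps the left side positive.\<close>
  then have "sqrt (1 - \<eta>\<^sup>2) * norm (a *\<^sub>R v) \<le> norm (a *\<^sub>R v + (- a / b) *\<^sub>R b *\<^sub>R v)"
    unfolding orth_D_def by blast
  also have "\<dots> = 0" using assms by simp
  finally have "sqrt (1 - \<eta>\<^sup>2) * norm (a *\<^sub>R v) \<le> 0" .
  moreover have "\<eta>\<^sup>2 < 1" using assms(1) by (simp add: abs_square_less_1)
  then have "sqrt (1 - \<eta>\<^sup>2) * norm (a *\<^sub>R v) > 0" using assms by simp
  ultimately show False by simp
qed

theorem theorem2p9:
  fixes \<epsilon> :: real
    and \<Delta> :: "'a::banach \<Rightarrow> 'a \<Rightarrow> bool"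
    and T :: "'a \<Rightarrow>\<^sub>L 'b::real_normed_vector"
  assumes "\<epsilon> \<in> {0..<1}"
    and "\<Delta> \<in> {orth_UI, orth_B, orth_Beps \<epsilon>, orth_D \<epsilon>}"
    and "\<exists>S::'a set. finite S \<and> span S = UNIV"
    and "norm T = 1"
  shows "(inj (blinfun_apply T) \<longleftrightarrow> (\<exists>\<beta>\<in>{0..<1}. D_reversing \<Delta> \<beta> T)) \<and>
         (inj (blinfun_apply T) \<longleftrightarrow> (\<exists>\<eta>\<in>{0..<1}. D_preserving \<Delta> \<eta> T))"
proof -
  have lin: "linear (blinfun_apply T)"
    by (simp add: blinfun.bounded_linear_right bounded_linear.linear)
  have fwd: "\<exists>k\<in>{0..<1}. D_reversing \<Delta> k T \<and> D_preserving \<Delta> k T"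
    if inj: "inj (blinfun_apply T)"
  proof -
    obtain m0 where m0: "m0 > 0" "\<And>v. m0 * norm v \<le> norm (T v)"
      using inj_bounded_below_finite_dim[OF blinfun.bounded_linear_right inj] assms(3) by metis
    \<comment> \<open>Capping at 1 ensures \<open>k \<le> 1\<close> below, so that
      \<open>sqrt (1 - k\<^sup>2)\<close> is an admissible parameter.\<close>
    define m where "m = min m0 1"
    have m: "0 < m" "m \<le> 1" using m0 by (auto simp: m_def)
    have mT: "m * norm v \<le> norm (T v)" for v
      using m0(2)[of v] mult_right_mono[of m m0 "norm v"] by (simp add: m_def)
    have Tle: "norm (T v) \<le> norm v" for v
      using norm_blinfun[of T v] assms(4) by simp
    obtain c where c: "0 < c" "c \<le> 1"
      and lb: "\<And>x y l. \<Delta> x y \<Longrightarrow> c * norm x \<le> norm (x + l *\<^sub>R y)"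
      using orth_uniform_lower_bound[OF assms(1,2)] by metis
    \<comment> \<open>The constant \<open>c / 2\<close> is valid for a related pair in either order,
      so a single parameter serves preservation and reversal.\<close>
    define k where "k = m * (c / 2)"
    have k: "0 < k" "k \<le> 1" using m c mult_le_one[of m "c / 2"] by (auto simp: k_def)
    have transport: "orth_D (sqrt (1 - k\<^sup>2)) (T x) (T y)"
      if "\<And>l. c / 2 * norm x \<le> norm (x + l *\<^sub>R y)" for x y
    proof -
      have "k * norm (T x) \<le> norm (T x + l *\<^sub>R T y)" for l
      proof -
        have "k * norm (T x) \<le> k * norm x" using Tle k by (intro mult_left_mono) auto
        also have "\<dots> = m * (c / 2 * norm x)" by (simp add: k_def)
        also have "\<dots> \<le> m * norm (x + l *\<^sub>R y)" using that m by (intro mult_left_mono) auto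
        also have "\<dots> \<le> norm (T (x + l *\<^sub>R y))" by (rule mT)
        finally show ?thesis by (simp add: blinfun.add_right blinfun.scaleR_right)
      qed
      then show ?thesis using k orth_D_sqrt_iff by (metis less_imp_le)
    qed
    have "D_preserving \<Delta> (sqrt (1 - k\<^sup>2)) T"
      unfolding D_preserving_def
    proof (intro allI impI transport)
      fix x y l
      assume "\<Delta> x y"
      then have "c * norm x \<le> norm (x + l *\<^sub>R y)" by (rule lb)
      moreover have "c / 2 * norm x \<le> c * norm x" using c by (intro mult_right_mono) auto
      ultimately show "c / 2 * norm x \<le> norm (x + l *\<^sub>R y)" by linarith
    qed
    moreover have "D_reversing \<Delta> (sqrt (1 - k\<^sup>2)) T"
      unfolding D_reversing_def
    proof (intro allI impI transport)
      fix x y l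
      assume "\<Delta> x y"
      then show "c / 2 * norm y \<le> norm (y + l *\<^sub>R x)"
        using c by (intro lower_bound_swap lb) auto
    qed
    moreover have "k\<^sup>2 \<le> 1" "0 < k\<^sup>2" using k by (simp_all add: power_le_one)
    then have "sqrt (1 - k\<^sup>2) \<in> {0..<1}" by simp
    ultimately show ?thesis by blast
  qed
  \<comment> \<open>Nonzero parallel images violate approximate orthogonality in either order, so
    one pair refutes both properties.\<close>
  have bwd: False
    if \<eta>: "\<eta> \<in> {0..<1}" and T: "D_reversing \<Delta> \<eta> T \<or> D_preserving \<Delta> \<eta> T"
      and ninj: "\<not> inj (blinfun_apply T)" for \<eta>
  proof -
    obtain z where z: "z \<noteq> 0" "T z = 0"
      using ninj linear_injective_0[OF lin] by blast
    have "T \<noteq> 0" using assms(4) by auto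
    then obtain u where u: "T u \<noteq> 0" by (metis blinfun_eqI zero_blinfun.rep_eq)
    obtain x y a b where xy: "\<Delta> x y" "T x = a *\<^sub>R T u" "T y = b *\<^sub>R T u" "a \<noteq> 0" "b \<noteq> 0"
      using orth_pair_outside_kernel[OF assms(1,2) lin z u] by metis
    show False
      using T xy not_orth_D_parallel[OF \<eta>] u unfolding D_preserving_def D_reversing_def by metis
  qed
  show ?thesis using fwd bwd by blast
qed

end
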